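(* A finite lattice is lower bounded if and only if it is join-semidistributive and has a strict facet labelling.
   Context: A finite lattice $L$ is lower bounded if there exist a finite set $X$ and a surjective lattice homomorphism $f:\mathcal{F}(X)\to L$ from the free lattice generated by $X$ such that, for each $y\in L$, the set $\{x\mid y\le f(x)\}$ is either empty or has a least element. A lattice is join-semidistributive if $x\vee y = x\vee z$ implies $x \vee (y\wedge z) = x\vee y$. Let $\prec$ denote the covering relation of $L$ and $\mathrm{Cov}(L)$ the set of covers, i.e. pairs $\gamma=(\gamma_0,\gamma_1)\in L^2$ with $\gamma_0\prec\gamma_1$. For $u\in L$ and $\gamma,\delta\in\mathrm{Cov}(L)$: - $\delta\searrow^{u}\gamma$ (pushdown) means $u\ne\delta_0$, $\gamma_0=u\wedge\delta_0$ and $\gamma_1\le u\prec\delta_1$; $\delta\searrow\gamma$ means $\delta\searrow^u\gamma$ for some $u\in L$; - $\gamma\nearrow^{w}\delta$ (pushup, $w\in L$) means $w\ne\gamma_1$, $\delta_1=w\vee\gamma_1$ and $\gamma_0\prec w\le\delta_0$; $\gamma\nearrow\delta$ means $\gamma\nearrow^w\delta$ for some $w\in L$; - $\gamma\,\mathcal{A}\,\delta$ means there exist $\epsilon\in\mathrm{Cov}(L)$ and $u\in L$ such that $\epsilon\searrow^u\delta$ and $\delta_1\le\gamma_0\prec\gamma_1\le u$; - dually, $\gamma\,\mathcal{B}\,\delta$ means there exist $\epsilon\in\mathrm{Cov}(L)$ and $u\in L$ such that $\epsilon\nearrow^u\delta$ and $u\le\gamma_0\prec\gamma_1\le\delta_0$.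 A strict lower facet labelling of $L$ is a function $f:\mathrm{Cov}(L)\to\mathbb{N}$ such that $f(\gamma)=f(\delta)$ if $\delta\searrow\gamma$, and $f(\gamma)<f(\delta)$ if $\delta\,\mathcal{A}\,\gamma$. A strict upper facet labelling is a function $f:\mathrm{Cov}(L)\to\mathbb{N}$ such that $f(\gamma)=f(\delta)$ if $\delta\nearrow\gamma$, and $f(\gamma)<f(\delta)$ if $\delta\,\mathcal{B}\,\gamma$. A strict facet labelling is a function $f:\mathrm{Cov}(L)\to\mathbb{N}$ that is both a strict lower and a strict upper facet labelling. *)

theory Defs
  imports Main
begin

unbundle lattice_syntax

section \<open>Free lattices\<close>

datatype 'x lterm = LVar 'x | LJoin "'x lterm" "'x lterm" | LMeet "'x lterm" "'x lterm"

text \<open>The least congruence on lattice terms containing the lattice identities.\<close>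

inductive lterm_eq :: "'x lterm \<Rightarrow> 'x lterm \<Rightarrow> bool" where
  refl: "lterm_eq s s"
| sym: "lterm_eq s t \<Longrightarrow> lterm_eq t s"
| trans: "lterm_eq s t \<Longrightarrow> lterm_eq t u \<Longrightarrow> lterm_eq s u"
| join_cong: "lterm_eq s s' \<Longrightarrow> lterm_eq t t' \<Longrightarrow> lterm_eq (LJoin s t) (LJoin s' t')"
| meet_cong: "lterm_eq s s' \<Longrightarrow> lterm_eq t t' \<Longrightarrow> lterm_eq (LMeet s t) (LMeet s' t')"
| join_comm: "lterm_eq (LJoin s t) (LJoin t s)"
| meet_comm: "lterm_eq (LMeet s t) (LMeet t s)"
| join_assoc: "lterm_eq (LJoin (LJoin s t) u) (LJoin s (LJoin t u))"
| meet_assoc: "lterm_eq (LMeet (LMeet s t) u) (LMeet s (LMeet t u))"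
| join_absorb: "lterm_eq (LJoin s (LMeet s t)) s"
| meet_absorb: "lterm_eq (LMeet s (LJoin s t)) s"

quotient_type 'x free_lattice = "'x lterm" / lterm_eq
proof (rule equivpI)
  show "reflp (lterm_eq :: 'x lterm \<Rightarrow> _)"
    by (rule reflpI) (rule lterm_eq.refl)
  show "symp (lterm_eq :: 'x lterm \<Rightarrow> _)"
    by (rule sympI) (rule lterm_eq.sym)
  show "transp (lterm_eq :: 'x lterm \<Rightarrow> _)"
    by (rule transpI) (rule lterm_eq.trans)
qed

lift_definition free_gen :: "'x \<Rightarrow> 'x free_lattice" is LVar .

instantiation free_lattice :: (type) lattice
begin

lift_definition sup_free_lattice :: "'a free_lattice \<Rightarrow> 'a free_lattice \<Rightarrow> 'a free_lattice"
  is LJoin by (rule lterm_eq.join_cong)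

lift_definition inf_free_lattice :: "'a free_lattice \<Rightarrow> 'a free_lattice \<Rightarrow> 'a free_lattice"
  is LMeet by (rule lterm_eq.meet_cong)

definition less_eq_free_lattice :: "'a free_lattice \<Rightarrow> 'a free_lattice \<Rightarrow> bool" where
  "less_eq_free_lattice a b \<longleftrightarrow> a \<sqinter> b = a"

definition less_free_lattice :: "'a free_lattice \<Rightarrow> 'a free_lattice \<Rightarrow> bool" where
  "less_free_lattice a b \<longleftrightarrow> a \<le> b \<and> \<not> b \<le> a"

instance
proof
  fix a b c :: "'a free_lattice"
  have sup_comm: "p \<squnion> q = q \<squnion> p" for p q :: "'a free_lattice"
    by transfer (rule lterm_eq.join_comm)
  have inf_comm: "p \<sqinter> q = q \<sqinter> p" for p q :: "'a free_lattice"
    by transfer (rule lterm_eq.meet_comm)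
  have sup_assoc: "(p \<squnion> q) \<squnion> r = p \<squnion> (q \<squnion> r)" for p q r :: "'a free_lattice"
    by transfer (rule lterm_eq.join_assoc)
  have inf_assoc: "(p \<sqinter> q) \<sqinter> r = p \<sqinter> (q \<sqinter> r)" for p q r :: "'a free_lattice"
    by transfer (rule lterm_eq.meet_assoc)
  have sup_absorb: "p \<squnion> (p \<sqinter> q) = p" for p q :: "'a free_lattice"
    by transfer (rule lterm_eq.join_absorb)
  have inf_absorb: "p \<sqinter> (p \<squnion> q) = p" for p q :: "'a free_lattice"
    by transfer (rule lterm_eq.meet_absorb)
  have idem: "p \<sqinter> p = p" for p :: "'a free_lattice"
    by (metis inf_absorb sup_absorb)
  have le_sup: "p \<le> q \<longleftrightarrow> p \<squnion> q = q" for p q :: "'a free_lattice"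
    unfolding less_eq_free_lattice_def by (metis inf_absorb sup_absorb sup_comm inf_comm)
  show "a < b \<longleftrightarrow> a \<le> b \<and> \<not> b \<le> a" by (rule less_free_lattice_def)
  show "a \<le> a" by (simp add: less_eq_free_lattice_def idem)
  show "a \<le> b \<Longrightarrow> b \<le> c \<Longrightarrow> a \<le> c"
    unfolding less_eq_free_lattice_def by (metis inf_assoc)
  show "a \<le> b \<Longrightarrow> b \<le> a \<Longrightarrow> a = b"
    unfolding less_eq_free_lattice_def by (metis inf_comm)
  show "a \<sqinter> b \<le> a" unfolding less_eq_free_lattice_def by (metis inf_assoc inf_comm idem)
  show "a \<sqinter> b \<le> b" unfolding less_eq_free_lattice_def by (metis inf_assoc idem)
  show "a \<le> b \<Longrightarrow> a \<le> c \<Longrightarrow> a \<le> b \<sqinter> c"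
    unfolding less_eq_free_lattice_def by (metis inf_assoc)
  show "a \<le> a \<squnion> b" by (simp add: less_eq_free_lattice_def inf_absorb)
  show "b \<le> a \<squnion> b" unfolding less_eq_free_lattice_def by (metis inf_absorb sup_comm)
  show "b \<le> a \<Longrightarrow> c \<le> a \<Longrightarrow> b \<squnion> c \<le> a"
    unfolding le_sup by (metis sup_assoc)
qed

end

text \<open>
  The free lattice on a set \<open>X\<close> of generators, as the sublattice of the free lattice on the whole
  type that \<open>X\<close> generates. Its universal property is \<open>free_lattice_on_universal\<close> below.
\<close>

inductive_set free_lattice_on :: "'x set \<Rightarrow> 'x free_lattice set" for X where
  gen: "x \<in> X \<Longrightarrow> free_gen x \<in> free_lattice_on X"
| sup: "a \<in> free_lattice_on X \<Longrightarrow> b \<in> free_lattice_on X \<Longrightarrow> a \<squnion> b \<in> free_lattice_on X"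
| inf: "a \<in> free_lattice_on X \<Longrightarrow> b \<in> free_lattice_on X \<Longrightarrow> a \<sqinter> b \<in> free_lattice_on X"

definition lattice_hom_on :: "'a::lattice set \<Rightarrow> ('a \<Rightarrow> 'b::lattice) \<Rightarrow> bool" where
  "lattice_hom_on A f \<longleftrightarrow>
     (\<forall>a\<in>A. \<forall>b\<in>A. f (a \<squnion> b) = f a \<squnion> f b \<and> f (a \<sqinter> b) = f a \<sqinter> f b)"

primrec lterm_eval :: "('x \<Rightarrow> 'b::lattice) \<Rightarrow> 'x lterm \<Rightarrow> 'b" where
  "lterm_eval h (LVar x) = h x"
| "lterm_eval h (LJoin s t) = lterm_eval h s \<squnion> lterm_eval h t"
| "lterm_eval h (LMeet s t) = lterm_eval h s \<sqinter> lterm_eval h t"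

lemma lterm_eq_eval: "lterm_eq s t \<Longrightarrow> lterm_eval h s = lterm_eval h t"
  by (induction rule: lterm_eq.induct) (simp_all add: ac_simps)

lift_definition free_extend :: "('x \<Rightarrow> 'b::lattice) \<Rightarrow> 'x free_lattice \<Rightarrow> 'b"
  is lterm_eval by (rule lterm_eq_eval)

theorem free_lattice_on_universal:
  fixes h :: "'x \<Rightarrow> 'b::lattice"
  shows "\<exists>f. lattice_hom_on (free_lattice_on X) f \<and> (\<forall>x\<in>X. f (free_gen x) = h x) \<and>
    (\<forall>g. lattice_hom_on (free_lattice_on X) g \<and> (\<forall>x\<in>X. g (free_gen x) = h x) \<longrightarrow>
       (\<forall>a\<in>free_lattice_on X. g a = f a))"
proof (intro exI conjI ballI allI impI)
  have ext_gen: "free_extend h (free_gen x) = h x" for x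
    by transfer simp
  have ext_hom: "free_extend h (a \<squnion> b) = free_extend h a \<squnion> free_extend h b \<and>
      free_extend h (a \<sqinter> b) = free_extend h a \<sqinter> free_extend h b" for a b
    by transfer simp
  show "lattice_hom_on (free_lattice_on X) (free_extend h)"
    by (simp add: lattice_hom_on_def ext_hom)
  show "free_extend h (free_gen x) = h x" for x by (rule ext_gen)
  fix g :: "'x free_lattice \<Rightarrow> 'b" and a
  assume g: "lattice_hom_on (free_lattice_on X) g \<and> (\<forall>x\<in>X. g (free_gen x) = h x)"
  assume "a \<in> free_lattice_on X"
  then show "g a = free_extend h a"
    by induction (use g in \<open>simp_all add: lattice_hom_on_def ext_hom ext_gen\<close>)
qed

section \<open>Lower bounded and join-semidistributive lattices\<close>

text \<open>
  Generators are taken from \<^typ>\<open>nat\<close>: HOL cannot quantify existentially over types, and every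
  finite set is in bijection with a finite set of natural numbers.
\<close>

definition lower_bounded_lattice :: "'a::lattice itself \<Rightarrow> bool" where
  "lower_bounded_lattice _ \<longleftrightarrow>
     (\<exists>(X :: nat set) (f :: nat free_lattice \<Rightarrow> 'a).
        finite X \<and> lattice_hom_on (free_lattice_on X) f \<and> f ` free_lattice_on X = UNIV \<and>
        (\<forall>y. {x \<in> free_lattice_on X. y \<le> f x} = {} \<or>
             (\<exists>m \<in> {x \<in> free_lattice_on X. y \<le> f x}.
                \<forall>x \<in> {x \<in> free_lattice_on X. y \<le> f x}. m \<le> x)))"

definition join_semidistributive :: "'a::lattice itself \<Rightarrow> bool" where
  "join_semidistributive _ \<longleftrightarrow>
     (\<forall>x y z :: 'a. x \<squnion> y = x \<squnion> z \<longrightarrow> x \<squnion> (y \<sqinter> z) = x \<squnion> y)"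

section \<open>Covers and strict facet labellings\<close>

definition covered_by :: "'a::order \<Rightarrow> 'a \<Rightarrow> bool" (infix "\<prec>" 50) where
  "x \<prec> y \<longleftrightarrow> x < y \<and> \<not> (\<exists>z. x < z \<and> z < y)"

definition Cov :: "('a::order \<times> 'a) set" where
  "Cov = {\<gamma>. fst \<gamma> \<prec> snd \<gamma>}"

definition pushdown_via :: "'a::lattice \<Rightarrow> 'a \<times> 'a \<Rightarrow> 'a \<times> 'a \<Rightarrow> bool" where
  "pushdown_via u \<delta> \<gamma> \<longleftrightarrow> \<delta> \<in> Cov \<and> \<gamma> \<in> Cov \<and>
     u \<noteq> fst \<delta> \<and> fst \<gamma> = u \<sqinter> fst \<delta> \<and> snd \<gamma> \<le> u \<and> u \<prec> snd \<delta>"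

definition pushdown :: "'a::lattice \<times> 'a \<Rightarrow> 'a \<times> 'a \<Rightarrow> bool" where
  "pushdown \<delta> \<gamma> \<longleftrightarrow> (\<exists>u. pushdown_via u \<delta> \<gamma>)"

definition pushup_via :: "'a::lattice \<Rightarrow> 'a \<times> 'a \<Rightarrow> 'a \<times> 'a \<Rightarrow> bool" where
  "pushup_via w \<gamma> \<delta> \<longleftrightarrow> \<gamma> \<in> Cov \<and> \<delta> \<in> Cov \<and>
     w \<noteq> snd \<gamma> \<and> snd \<delta> = w \<squnion> snd \<gamma> \<and> fst \<gamma> \<prec> w \<and> w \<le> fst \<delta>"

definition pushup :: "'a::lattice \<times> 'a \<Rightarrow> 'a \<times> 'a \<Rightarrow> bool" where
  "pushup \<gamma> \<delta> \<longleftrightarrow> (\<exists>w. pushup_via w \<gamma> \<delta>)"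

definition rel_A :: "'a::lattice \<times> 'a \<Rightarrow> 'a \<times> 'a \<Rightarrow> bool" where
  "rel_A \<gamma> \<delta> \<longleftrightarrow> \<gamma> \<in> Cov \<and> \<delta> \<in> Cov \<and>
     (\<exists>\<epsilon>\<in>Cov. \<exists>u. pushdown_via u \<epsilon> \<delta> \<and> snd \<delta> \<le> fst \<gamma> \<and> fst \<gamma> \<prec> snd \<gamma> \<and> snd \<gamma> \<le> u)"

definition rel_B :: "'a::lattice \<times> 'a \<Rightarrow> 'a \<times> 'a \<Rightarrow> bool" where
  "rel_B \<gamma> \<delta> \<longleftrightarrow> \<gamma> \<in> Cov \<and> \<delta> \<in> Cov \<and>
     (\<exists>\<epsilon>\<in>Cov. \<exists>u. pushup_via u \<epsilon> \<delta> \<and> u \<le> fst \<gamma> \<and> fst \<gamma> \<prec> snd \<gamma> \<and> snd \<gamma> \<le> fst \<delta>)"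

text \<open>
  A labelling of \<^const>\<open>Cov\<close> is a total function on pairs; its values outside \<^const>\<open>Cov\<close> are never
  constrained, because all four relations above only hold between covers.
\<close>

definition strict_lower_facet_labelling :: "('a::lattice \<times> 'a \<Rightarrow> nat) \<Rightarrow> bool" where
  "strict_lower_facet_labelling f \<longleftrightarrow>
     (\<forall>\<gamma>\<in>Cov. \<forall>\<delta>\<in>Cov. (pushdown \<delta> \<gamma> \<longrightarrow> f \<gamma> = f \<delta>) \<and> (rel_A \<delta> \<gamma> \<longrightarrow> f \<gamma> < f \<delta>))"

definition strict_upper_facet_labelling :: "('a::lattice \<times> 'a \<Rightarrow> nat) \<Rightarrow> bool" where
  "strict_upper_facet_labelling f \<longleftrightarrow>
     (\<forall>\<gamma>\<in>Cov. \<forall>\<delta>\<in>Cov. (pushup \<delta> \<gamma> \<longrightarrow> f \<gamma> = f \<delta>) \<and> (rel_B \<delta> \<gamma> \<longrightarrow> f \<gamma> < f \<delta>))"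

definition strict_facet_labelling :: "('a::lattice \<times> 'a \<Rightarrow> nat) \<Rightarrow> bool" where
  "strict_facet_labelling f \<longleftrightarrow>
     strict_lower_facet_labelling f \<and> strict_upper_facet_labelling f"

end

theory Submission imports Defs begin

text \<open>
  The bridge between both sides is the join dependency relation: \<open>p\<close> depends on \<open>q\<close> if
  \<open>p \<le> q \<squnion> x\<close> nontrivially for some \<open>x\<close> above everything strictly below \<open>q\<close>.

  If \<open>f\<close> maps the free lattice onto \<open>L\<close> and \<open>\<beta> y\<close> is the least preimage of the up-set of \<open>y\<close>,
  then Whitman's condition stratifies the free lattice into levels such that \<open>\<beta> q\<close> has a smaller
  level than \<open>\<beta> p\<close> whenever \<open>p\<close> depends on \<open>q\<close>. In a join-semidistributive lattice every cover
  \<open>\<gamma>\<close> has a least \<open>j\<close> with \<open>\<gamma>\<^sub>0 \<squnion> j = \<gamma>\<^sub>1\<close>, invariant under pushups and pushdowns, and the level of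
  \<open>\<beta> j\<close> is the required label.

  Conversely, let \<open>f\<close> be a strict facet labelling. The covers that have a label greater than \<open>n\<close>, or
  that have label \<open>n\<close> and a given \<open>j\<close>, are closed under the local forcing rules, hence are
  the covers collapsed by a congruence. Therefore labels strictly decrease along join dependencies,
  and the least preimages can be built by induction on labels.
\<close>

section \<open>Whitman's condition\<close>

text \<open>Whitman's solution of the word problem, as a cut-free sequent calculus.\<close>

inductive whitman_le :: "'x lterm \<Rightarrow> 'x lterm \<Rightarrow> bool" where
  var: "whitman_le (LVar x) (LVar x)"
| join_left: "whitman_le s u \<Longrightarrow> whitman_le t u \<Longrightarrow> whitman_le (LJoin s t) u"
| meet_right: "whitman_le s t \<Longrightarrow> whitman_le s u \<Longrightarrow> whitman_le s (LMeet t u)"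
| meet_left1: "whitman_le s u \<Longrightarrow> whitman_le (LMeet s t) u"
| meet_left2: "whitman_le t u \<Longrightarrow> whitman_le (LMeet s t) u"
| join_right1: "whitman_le s t \<Longrightarrow> whitman_le s (LJoin t u)"
| join_right2: "whitman_le s u \<Longrightarrow> whitman_le s (LJoin t u)"

lemma whitman_le_refl: "whitman_le s s"
  by (induction s) (auto intro: whitman_le.intros)

text \<open>The left join rule is invertible; this and its dual for meets take apart the cut term in
  the proof of transitivity.\<close>

lemma whitman_le_joinD: "whitman_le (LJoin s t) u \<Longrightarrow> whitman_le s u \<and> whitman_le t u"
  by (induction "LJoin s t" u rule: whitman_le.induct) (auto intro: whitman_le.intros)

lemma whitman_le_meetD: "whitman_le s (LMeet t u) \<Longrightarrow> whitman_le s t \<and> whitman_le s u"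
  by (induction s "LMeet t u" rule: whitman_le.induct) (auto intro: whitman_le.intros)

text \<open>Cut elimination, with the outer induction on the cut term. For a join, the right premise
  is inverted and the left derivation is followed up to a right join rule introducing the cut term,
  where the cut passes to a joinand; meets are dual.\<close>

lemma whitman_le_trans: "whitman_le s t \<Longrightarrow> whitman_le t u \<Longrightarrow> whitman_le s u"
proof (induction t arbitrary: s u)
  case (LVar x)
  then show ?case
    by (induction s "LVar x" rule: whitman_le.induct) (auto intro: whitman_le.intros)
next
  case (LJoin t1 t2)
  have "whitman_le t1 u" "whitman_le t2 u"
    using whitman_le_joinD[OF LJoin.prems(2)] by auto
  with LJoin.prems(1) show ?case
    by (induction s "LJoin t1 t2" rule: whitman_le.induct)
      (auto intro: whitman_le.intros LJoin.IH)
next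
  case (LMeet t1 t2)
  have "whitman_le s t1" "whitman_le s t2"
    using whitman_le_meetD[OF LMeet.prems(1)] by auto
  with LMeet.prems(2) show ?case
    by (induction "LMeet t1 t2" u rule: whitman_le.induct)
      (auto intro: whitman_le.intros LMeet.IH)
qed

text \<open>Mutual derivability is a congruence satisfying the lattice identities, so it contains
  the least one.\<close>

lemma lterm_eq_imp_whitman_le: "lterm_eq s t \<Longrightarrow> whitman_le s t \<and> whitman_le t s"
proof (induction rule: lterm_eq.induct)
  case (trans s t u)
  then show ?case by (blast intro: whitman_le_trans)
qed (blast intro: whitman_le.intros whitman_le_refl)+

lemma whitman_le_imp_le:
  "whitman_le s t \<Longrightarrow> abs_free_lattice s \<le> abs_free_lattice t"
  by (induction rule: whitman_le.induct)
    (auto simp flip: sup_free_lattice.abs_eq inf_free_lattice.abs_eq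
      intro: le_infI1 le_infI2 le_supI1 le_supI2)

lemma abs_free_lattice_le_iff:
  "abs_free_lattice s \<le> abs_free_lattice t \<longleftrightarrow> whitman_le s t"
proof
  assume "abs_free_lattice s \<le> abs_free_lattice t"
  then have "lterm_eq (LMeet s t) s"
    by (simp add: less_eq_free_lattice_def inf_free_lattice.abs_eq free_lattice.abs_eq_iff)
  then show "whitman_le s t"
    using lterm_eq_imp_whitman_le whitman_le_meetD by blast
qed (rule whitman_le_imp_le)

lemma abs_free_lattice_surj: "\<exists>s. a = abs_free_lattice s"
  by (induction a rule: free_lattice.abs_induct) auto

text \<open>A derivation of a meet below a join ends in one of the two left meet rules or the two
  right join rules; these give the four alternatives.\<close>

lemma free_lattice_whitman:
  fixes a b c d :: "'x free_lattice"
  assumes "a \<sqinter> b \<le> c \<squnion> d"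
  shows "a \<sqinter> b \<le> c \<or> a \<sqinter> b \<le> d \<or> a \<le> c \<squnion> d \<or> b \<le> c \<squnion> d"
proof -
  obtain s t u v where "a = abs_free_lattice s" "b = abs_free_lattice t"
      "c = abs_free_lattice u" "d = abs_free_lattice v"
    using abs_free_lattice_surj by metis
  with assms show ?thesis
    by (auto simp: sup_free_lattice.abs_eq inf_free_lattice.abs_eq abs_free_lattice_le_iff
        elim: whitman_le.cases)
qed

lemma free_gen_join_prime:
  fixes c d :: "'x free_lattice"
  assumes "free_gen x \<le> c \<squnion> d"
  shows "free_gen x \<le> c \<or> free_gen x \<le> d"
proof -
  obtain u v where "c = abs_free_lattice u" "d = abs_free_lattice v"
    using abs_free_lattice_surj by metis
  with assms show ?thesis
    by (auto simp: sup_free_lattice.abs_eq free_gen.abs_eq abs_free_lattice_le_iff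
        elim: whitman_le.cases)
qed

section \<open>Levels of the free lattice\<close>

text \<open>Only nonempty finite joins are formed. Hence \<open>joins {}\<close> is empty, which is
  what makes the elements of level \<open>1\<close> below join-prime.\<close>

inductive_set joins :: "'a::lattice set \<Rightarrow> 'a set" for S where
  base: "a \<in> S \<Longrightarrow> a \<in> joins S"
| sup: "a \<in> joins S \<Longrightarrow> b \<in> joins S \<Longrightarrow> a \<squnion> b \<in> joins S"

lemma joins_mono: "S \<subseteq> T \<Longrightarrow> joins S \<subseteq> joins T"
proof
  fix a assume "S \<subseteq> T" "a \<in> joins S"
  from this(2,1) show "a \<in> joins T"
    by induction (auto intro: joins.intros)
qed

lemma joins_le: "w \<in> joins S \<Longrightarrow> (\<And>s. s \<in> S \<Longrightarrow> s \<le> b) \<Longrightarrow> w \<le> b"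
  by (induction rule: joins.induct) auto

text \<open>Level \<open>0\<close> is empty, so level \<open>1\<close> consists of the join-prime elements.\<close>

primrec free_level :: "'x set \<Rightarrow> nat \<Rightarrow> 'x free_lattice set" where
  "free_level X 0 = {}"
| "free_level X (Suc k) = {v \<in> free_lattice_on X. \<forall>c d. v \<le> c \<squnion> d \<longrightarrow>
     v \<le> c \<or> v \<le> d \<or> (\<exists>w \<in> joins {s \<in> free_level X k. s \<le> c \<or> s \<le> d}. v \<le> w)}"

lemma free_level_subset: "free_level X k \<subseteq> free_lattice_on X"
  by (cases k) auto

lemma free_level_Suc_mono: "free_level X k \<subseteq> free_level X (Suc k)"
proof (induction k)
  case (Suc k)
  have "joins {s \<in> free_level X k. s \<le> c \<or> s \<le> d} \<subseteq>
      joins {s \<in> free_level X (Suc k). s \<le> c \<or> s \<le> d}" for c d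
    using Suc.IH by (intro joins_mono) auto
  then show ?case
    unfolding free_level.simps(2)[of X "Suc k"] free_level.simps(2)[of X k]
    by blast
qed simp

lemma free_level_mono: "k \<le> m \<Longrightarrow> free_level X k \<subseteq> free_level X m"
  by (rule lift_Suc_mono_le[of "free_level X"]) (rule free_level_Suc_mono)

text \<open>Each joinand of \<open>w\<close> lies below \<open>c\<close> or \<open>d\<close>, or is
  refined by the definition of its level; the join of the refinements refines
  \<open>w\<close>.\<close>

lemma free_level_refine:
  assumes "w \<in> joins (free_level X k)" "w \<le> c \<squnion> d"
  shows "\<exists>w' \<in> joins {s \<in> free_level X k. s \<le> c \<or> s \<le> d}. w \<le> w'"
  using assms
proof (induction rule: joins.induct)
  case (base v)
  \<comment> \<open>Since level \<open>0\<close> is empty, \<open>k\<close> is a successor, and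
    \<open>v\<close> is refined by elements of level \<open>m\<close>, which belong to level
    \<open>k\<close> as well.\<close>
  then obtain m where m: "k = Suc m" by (cases k) auto
  have "joins {s \<in> free_level X m. s \<le> c \<or> s \<le> d} \<subseteq>
      joins {s \<in> free_level X k. s \<le> c \<or> s \<le> d}"
    unfolding m using free_level_Suc_mono by (intro joins_mono) blast
  moreover have "v \<le> c \<or> v \<le> d \<or> (\<exists>w \<in> joins {s \<in> free_level X m. s \<le> c \<or> s \<le> d}. v \<le> w)"
    using base m by simp
  ultimately show ?case
    using base(1) by (blast intro: joins.base)
next
  case (sup a b)
  then obtain a' b' where
    "a' \<in> joins {s \<in> free_level X k. s \<le> c \<or> s \<le> d}" "a \<le> a'"
    "b' \<in> joins {s \<in> free_level X k. s \<le> c \<or> s \<le> d}" "b \<le> b'"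
    by auto
  then show ?case
    by (intro bexI[of _ "a' \<squnion> b'"]) (auto intro: joins.sup le_supI1 le_supI2)
qed

text \<open>Generators are join-prime, hence of level \<open>1\<close>. For a meet, Whitman's
  condition reduces every join cover to a trivial one or to a join cover of one factor, which can be
  refined; so the meet itself belongs to the next level.\<close>

lemma free_lattice_on_joins_level:
  assumes "a \<in> free_lattice_on X"
  shows "\<exists>k. a \<in> joins (free_level X k)"
  using assms
proof (induction rule: free_lattice_on.induct)
  case (gen x)
  then have "free_gen x \<in> free_level X (Suc 0)"
    by (auto intro: free_lattice_on.gen dest: free_gen_join_prime)
  then show ?case by (blast intro: joins.base)
next
  case (sup a b)
  then obtain k m where "a \<in> joins (free_level X k)" "b \<in> joins (free_level X m)" by blast
  then have "a \<in> joins (free_level X (max k m))" "b \<in> joins (free_level X (max k m))"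
    using joins_mono[OF free_level_mono] by (meson max.cobounded1 max.cobounded2 subsetD)+
  then show ?case by (blast intro: joins.sup)
next
  case (inf a b)
  then obtain k m where "a \<in> joins (free_level X k)" "b \<in> joins (free_level X m)" by blast
  then have "a \<in> joins (free_level X (max k m))" "b \<in> joins (free_level X (max k m))"
    using joins_mono[OF free_level_mono] by (meson max.cobounded1 max.cobounded2 subsetD)+
  note refine = this[THEN free_level_refine]
  have "a \<sqinter> b \<le> c \<or> a \<sqinter> b \<le> d \<or>
      (\<exists>w \<in> joins {s \<in> free_level X (max k m). s \<le> c \<or> s \<le> d}. a \<sqinter> b \<le> w)"
    if "a \<sqinter> b \<le> c \<squnion> d" for c d
    using free_lattice_whitman[OF that] refine[of c d] by (meson le_infI1 le_infI2)
  then have "a \<sqinter> b \<in> free_level X (Suc (max k m))"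
    using inf.hyps by (simp add: free_lattice_on.inf)
  then show ?case by (blast intro: joins.base)
qed

text \<open>An element of a level below the common join is below \<open>x\<close>, below
  \<open>y \<sqinter> z\<close>, or nontrivially covered by the join of \<open>x\<close> with one of
  \<open>y\<close>, \<open>z\<close>. In the last case it is refined by elements of the previous
  level, to which induction applies.\<close>

lemma free_lattice_on_joinSD:
  fixes x y z :: "'x free_lattice"
  assumes in_X: "x \<in> free_lattice_on X" "y \<in> free_lattice_on X"
    and eq: "x \<squnion> y = x \<squnion> z"
  shows "x \<squnion> (y \<sqinter> z) = x \<squnion> y"
proof (rule antisym)
  have level: "v \<in> free_level X k \<Longrightarrow> v \<le> x \<squnion> y \<Longrightarrow> v \<le> x \<squnion> (y \<sqinter> z)" for v k
  proof (induction k arbitrary: v)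
    case (Suc k)
    show ?case
    proof (cases "v \<le> x \<or> v \<le> y \<and> v \<le> z")
      case True
      then show ?thesis by (auto intro: le_supI1 le_supI2)
    next
      case False
      then obtain t where t: "t \<in> {y, z}" "\<not> v \<le> x" "\<not> v \<le> t" by blast
      then have "v \<le> x \<squnion> t" using Suc.prems(2) eq by auto
      then obtain w where w: "w \<in> joins {s \<in> free_level X k. s \<le> x \<or> s \<le> t}" "v \<le> w"
        using Suc.prems(1) t by auto
      \<comment> \<open>The induction hypothesis requires the refining elements to lie below
        \<open>x \<squnion> y\<close>; for \<open>t = z\<close> this comes from the equality of the
        two joins.\<close>
      have "s \<le> x \<squnion> y" if "s \<le> x \<or> s \<le> t" for s
        using that t(1) eq by (metis insertE le_supI1 le_supI2 singletonD)
      then have "w \<le> x \<squnion> (y \<sqinter> z)"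
        using w(1) Suc.IH by (auto elim!: joins_le)
      then show ?thesis using w(2) by order
    qed
  qed simp
  obtain k where "x \<squnion> y \<in> joins (free_level X k)"
    using free_lattice_on_joins_level in_X free_lattice_on.sup by blast
  then obtain w where w: "w \<in> joins {s \<in> free_level X k. s \<le> x \<or> s \<le> y}" "x \<squnion> y \<le> w"
    using free_level_refine by blast
  have "w \<le> x \<squnion> (y \<sqinter> z)"
    using w(1) level by (auto elim!: joins_le intro: le_supI1 le_supI2)
  with w(2) show "x \<squnion> y \<le> x \<squnion> (y \<sqinter> z)" by order
qed (simp add: le_supI2 le_infI1)

section \<open>Join dependency and least preimages\<close>

text \<open>For join-irreducible \<open>p\<close> and \<open>q\<close> this is the relation D of
  join dependency: \<open>x\<close> absorbs every \<open>r < q\<close>, so \<open>q\<close> cannot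
  be shrunk in the cover \<open>p \<le> q \<squnion> x\<close>.\<close>

definition depends :: "'a::lattice \<Rightarrow> 'a \<Rightarrow> bool" where
  "depends p q \<longleftrightarrow> (\<exists>x. p \<le> q \<squnion> x \<and> \<not> p \<le> q \<and> \<not> p \<le> x \<and> (\<forall>r<q. r \<le> x))"

text \<open>\<open>\<beta>\<close> is the lower adjoint of \<open>f\<close> on the generated
  sublattice; \<open>f_least\<close> also encodes that \<open>f\<close> is onto.\<close>

locale lower_bounded_epi =
  fixes X :: "'x set" and f :: "'x free_lattice \<Rightarrow> 'a::lattice" and \<beta> :: "'a \<Rightarrow> 'x free_lattice"
  assumes hom: "lattice_hom_on (free_lattice_on X) f"
    and least_in: "\<beta> y \<in> free_lattice_on X"
    and f_least: "f (\<beta> y) = y"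
    and least_le: "x \<in> free_lattice_on X \<Longrightarrow> y \<le> f x \<Longrightarrow> \<beta> y \<le> x"
begin

lemma f_sup: "a \<in> free_lattice_on X \<Longrightarrow> b \<in> free_lattice_on X \<Longrightarrow> f (a \<squnion> b) = f a \<squnion> f b"
  and f_inf: "a \<in> free_lattice_on X \<Longrightarrow> b \<in> free_lattice_on X \<Longrightarrow> f (a \<sqinter> b) = f a \<sqinter> f b"
  using hom by (auto simp: lattice_hom_on_def)

lemma f_mono:
  assumes "a \<in> free_lattice_on X" "b \<in> free_lattice_on X" "a \<le> b"
  shows "f a \<le> f b"
  using f_sup[OF assms(1,2)] assms(3) by (simp add: sup.absorb2 sup.order_iff ac_simps)

text \<open>Lower adjoints preserve joins.\<close>

lemma least_sup: "\<beta> (a \<squnion> b) = \<beta> a \<squnion> \<beta> b"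
proof (rule antisym)
  show "\<beta> (a \<squnion> b) \<le> \<beta> a \<squnion> \<beta> b"
    by (rule least_le) (simp_all add: free_lattice_on.sup least_in f_sup f_least)
  show "\<beta> a \<squnion> \<beta> b \<le> \<beta> (a \<squnion> b)"
    by (intro le_supI least_le) (simp_all add: least_in f_least)
qed

text \<open>\<open>\<beta>\<close> carries the join equation into the free lattice, which is
  join-semidistributive, and \<open>f\<close> carries the conclusion back.\<close>

lemma joinSD: "join_semidistributive TYPE('a)"
  unfolding join_semidistributive_def
proof (intro allI impI)
  fix x y z :: 'a
  assume "x \<squnion> y = x \<squnion> z"
  then have "\<beta> x \<squnion> \<beta> y = \<beta> x \<squnion> \<beta> z" by (simp flip: least_sup)
  then have "f (\<beta> x \<squnion> (\<beta> y \<sqinter> \<beta> z)) = f (\<beta> x \<squnion> \<beta> y)"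
    by (simp add: free_lattice_on_joinSD[OF least_in least_in])
  then show "x \<squnion> (y \<sqinter> z) = x \<squnion> y"
    by (simp add: f_sup f_inf f_least least_in free_lattice_on.intros)
qed

lemma joins_not_le:
  assumes "w \<in> joins S" "S \<subseteq> free_lattice_on X" "\<not> f w \<le> x"
  shows "\<exists>v\<in>S. v \<le> w \<and> \<not> f v \<le> x"
proof -
  \<comment> \<open>Membership is carried along because \<open>f\<close> is known to preserve joins
    only on \<open>free_lattice_on X\<close>.\<close>
  have "w \<in> free_lattice_on X \<and> (f w \<le> x \<or> (\<exists>v\<in>S. v \<le> w \<and> \<not> f v \<le> x))"
    using assms(1)
  proof (induction rule: joins.induct)
    case (base a)
    then show ?case using assms(2) by blast
  next
    case (sup a b)
    then show ?case by (auto simp: f_sup intro: free_lattice_on.sup le_supI1 le_supI2)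
  qed
  with assms(3) show ?thesis by blast
qed

text \<open>The hypotheses encode, here and later, that \<open>p\<close> is join-irreducible with
  lower cover \<open>p\<^sub>0\<close>. Some joinand of \<open>\<beta> p\<close> is not mapped below
  \<open>p\<^sub>0\<close>, so it is mapped onto \<open>p\<close>, and leastness makes it equal to
  \<open>\<beta> p\<close>.\<close>

lemma least_in_level:
  assumes "p\<^sub>0 < p" "\<And>r. r < p \<Longrightarrow> r \<le> p\<^sub>0"
  shows "\<exists>k. \<beta> p \<in> free_level X k"
proof -
  obtain k where "\<beta> p \<in> joins (free_level X k)"
    using free_lattice_on_joins_level least_in by blast
  then obtain v where v: "v \<in> free_level X k" "v \<le> \<beta> p" "\<not> f v \<le> p\<^sub>0"
    using joins_not_le[OF _ free_level_subset, of "\<beta> p" k p\<^sub>0] assms(1)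
    by (auto simp: f_least less_le_not_le)
  then have vX: "v \<in> free_lattice_on X" using free_level_subset by blast
  have "f v = p" using f_mono[OF vX least_in v(2)] assms(2) v(3) by (auto simp: f_least order_le_less)
  then have "v = \<beta> p" using least_le[OF vX] v(2) by (simp add: antisym)
  with v(1) show ?thesis by blast
qed

text \<open>The dependency lifts to a nontrivial join cover of \<open>\<beta> p\<close> by
  \<open>\<beta> q\<close> and \<open>\<beta> x\<close>. Some element of its refinement is not
  mapped below \<open>x\<close>; it lies below \<open>\<beta> q\<close> and is mapped onto
  \<open>q\<close>, so it is \<open>\<beta> q\<close>.\<close>

lemma depends_level:
  assumes "depends p q" "\<beta> p \<in> free_level X (Suc k)"
  shows "\<beta> q \<in> free_level X k"
proof -
  obtain x where x: "p \<le> q \<squnion> x" "\<not> p \<le> q" "\<not> p \<le> x" "\<And>r. r < q \<Longrightarrow> r \<le> x"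
    using assms(1) by (auto simp: depends_def)
  have "\<beta> p \<le> \<beta> q \<squnion> \<beta> x"
    by (rule least_le) (simp_all add: free_lattice_on.sup least_in f_sup f_least x(1))
  moreover have "\<beta> a \<le> \<beta> b \<Longrightarrow> a \<le> b" for a b
    using f_mono[OF least_in least_in] by (simp add: f_least)
  ultimately obtain w where
    w: "w \<in> joins {s \<in> free_level X k. s \<le> \<beta> q \<or> s \<le> \<beta> x}" "\<beta> p \<le> w"
    using assms(2) x(2,3) by (simp, meson)
  have sub: "{s \<in> free_level X k. s \<le> \<beta> q \<or> s \<le> \<beta> x} \<subseteq> free_lattice_on X"
    using free_level_subset by blast
  have "w \<in> free_lattice_on X"
    using w(1) sub by (induction rule: joins.induct) (auto intro: free_lattice_on.sup)
  then have "\<not> f w \<le> x"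
    using f_mono[OF least_in _ w(2)] x(3) by (auto simp: f_least)
  then obtain v where v: "v \<in> free_level X k" "v \<le> \<beta> q \<or> v \<le> \<beta> x" "\<not> f v \<le> x"
    using joins_not_le[OF w(1) sub] by blast
  have vX: "v \<in> free_lattice_on X" using v(1) free_level_subset by blast
  have "v \<le> \<beta> q" using f_mono[OF vX least_in, of x] v(2,3) by (auto simp: f_least)
  moreover have "f v = q"
    using f_mono[OF vX least_in \<open>v \<le> \<beta> q\<close>] x(4) v(3) by (auto simp: f_least order_le_less)
  ultimately have "v = \<beta> q" using least_le[OF vX] by (simp add: antisym)
  with v(1) show ?thesis by simp
qed

text \<open>Meaningful when \<open>\<beta> p\<close> lies in some level, as it does for
  join-irreducible \<open>p\<close>; otherwise the value is unspecified.\<close>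

definition rank :: "'a \<Rightarrow> nat" where
  "rank p = (LEAST k. \<beta> p \<in> free_level X k)"

lemma depends_rank:
  assumes "depends p q" "p\<^sub>0 < p" "\<And>r. r < p \<Longrightarrow> r \<le> p\<^sub>0"
  shows "rank q < rank p"
proof -
  have p: "\<beta> p \<in> free_level X (rank p)"
    unfolding rank_def using least_in_level[OF assms(2,3)] by (rule LeastI_ex)
  \<comment> \<open>The rank is positive because level \<open>0\<close> is empty.\<close>
  then obtain k where k: "rank p = Suc k" by (cases "rank p") auto
  then have "rank q \<le> k"
    unfolding rank_def[of q] using depends_level[OF assms(1)] p by (simp add: Least_le)
  with k show ?thesis by simp
qed

end

section \<open>The join-irreducible below a cover\<close>

lemma covered_by_between: "a \<prec> b \<Longrightarrow> a \<le> c \<Longrightarrow> c \<le> b \<Longrightarrow> c = a \<or> c = b"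
  unfolding covered_by_def by (metis order_le_less)

lemma covered_by_sup:
  fixes a b y :: "'a::lattice"
  assumes "a \<prec> b"
  shows "a \<squnion> y = b \<longleftrightarrow> y \<le> b \<and> \<not> y \<le> a"
  using assms covered_by_between[OF assms, of "a \<squnion> y"]
  by (metis covered_by_def le_supI less_imp_le less_le_not_le sup.cobounded1 sup.cobounded2 sup.order_iff)

text \<open>An arbitrary finite lattice may lack such a least element; join-semidistributivity
  supplies it.\<close>

definition cover_irr :: "'a::lattice \<times> 'a \<Rightarrow> 'a" where
  "cover_irr \<gamma> = (LEAST y. fst \<gamma> \<squnion> y = snd \<gamma>)"

text \<open>Join-semidistributivity closes the set of solutions under binary meets, so a minimal
  solution is least.\<close>

lemma cover_irr_least:
  fixes \<gamma> :: "'a::{finite,lattice} \<times> 'a"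
  assumes sd: "join_semidistributive TYPE('a)" and "\<gamma> \<in> Cov"
  shows "fst \<gamma> \<squnion> cover_irr \<gamma> = snd \<gamma>" "fst \<gamma> \<squnion> y = snd \<gamma> \<Longrightarrow> cover_irr \<gamma> \<le> y"
proof -
  let ?S = "{y. fst \<gamma> \<squnion> y = snd \<gamma>}"
  have "snd \<gamma> \<in> ?S"
    using assms(2) by (auto simp: Cov_def covered_by_def sup.absorb2)
  then obtain m where m: "m \<in> ?S" "\<And>y. y \<in> ?S \<Longrightarrow> y \<le> m \<Longrightarrow> m = y"
    using finite_has_minimal[of ?S] by auto
  have least: "m \<le> y" if "y \<in> ?S" for y
  proof -
    have "m \<sqinter> y \<in> ?S"
      using sd that m(1) unfolding join_semidistributive_def by simp
    then show ?thesis using m(2)[of "m \<sqinter> y"] by (metis inf.cobounded1 inf.cobounded2)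
  qed
  have "cover_irr \<gamma> = m"
    unfolding cover_irr_def using m(1) least by (intro Least_equality) auto
  then show "fst \<gamma> \<squnion> cover_irr \<gamma> = snd \<gamma>" "fst \<gamma> \<squnion> y = snd \<gamma> \<Longrightarrow> cover_irr \<gamma> \<le> y"
    using m(1) least by auto
qed

lemma cover_irr_not_le:
  fixes \<gamma> :: "'a::{finite,lattice} \<times> 'a"
  assumes "join_semidistributive TYPE('a)" "\<gamma> \<in> Cov"
  shows "cover_irr \<gamma> \<le> snd \<gamma>" "\<not> cover_irr \<gamma> \<le> fst \<gamma>"
  using cover_irr_least(1)[OF assms] covered_by_sup assms(2) by (auto simp: Cov_def)

text \<open>Otherwise \<open>r\<close> would be a smaller solution of the defining equation. This is
  what makes \<open>cover_irr \<gamma>\<close> join-irreducible.\<close>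

lemma less_cover_irr:
  fixes \<gamma> :: "'a::{finite,lattice} \<times> 'a"
  assumes "join_semidistributive TYPE('a)" "\<gamma> \<in> Cov" "r < cover_irr \<gamma>"
  shows "r \<le> fst \<gamma>"
proof (rule ccontr)
  assume "\<not> r \<le> fst \<gamma>"
  moreover have "r \<le> snd \<gamma>" using cover_irr_not_le(1)[OF assms(1,2)] assms(3) by order
  ultimately have "fst \<gamma> \<squnion> r = snd \<gamma>" using covered_by_sup assms(2) by (auto simp: Cov_def)
  then show False using cover_irr_least(2)[OF assms(1,2)] assms(3) by (auto simp: less_le_not_le)
qed

text \<open>Each of the two irreducibles solves the defining equation of the other.\<close>

lemma cover_irr_perspective:
  fixes \<gamma> \<delta> :: "'a::{finite,lattice} \<times> 'a"
  assumes sd: "join_semidistributive TYPE('a)" and cov: "\<gamma> \<in> Cov" "\<delta> \<in> Cov"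
    and le: "fst \<gamma> \<le> fst \<delta>" "snd \<gamma> \<le> snd \<delta>" "\<not> snd \<gamma> \<le> fst \<delta>"
  shows "cover_irr \<gamma> = cover_irr \<delta>"
proof (rule antisym)
  have c: "fst \<gamma> \<prec> snd \<gamma>" "fst \<delta> \<prec> snd \<delta>" using cov by (auto simp: Cov_def)
  note \<gamma> = cover_irr_least[OF sd cov(1)] cover_irr_not_le[OF sd cov(1)]
  note \<delta> = cover_irr_least[OF sd cov(2)] cover_irr_not_le[OF sd cov(2)]
  have "\<not> cover_irr \<gamma> \<le> fst \<delta>" using \<gamma>(1) le by (metis le_supI)
  moreover have "cover_irr \<gamma> \<le> snd \<delta>" using \<gamma>(3) le(2) by order
  ultimately have "fst \<delta> \<squnion> cover_irr \<gamma> = snd \<delta>" by (simp add: covered_by_sup[OF c(2)])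
  then show "cover_irr \<delta> \<le> cover_irr \<gamma>" by (rule \<delta>(2))
  have "fst \<delta> \<squnion> snd \<gamma> = snd \<delta>" using le by (simp add: covered_by_sup[OF c(2)])
  then have "cover_irr \<delta> \<le> snd \<gamma>" by (rule \<delta>(2))
  moreover have "\<not> cover_irr \<delta> \<le> fst \<gamma>" using \<delta>(4) le(1) by order
  ultimately have "fst \<gamma> \<squnion> cover_irr \<delta> = snd \<gamma>" by (simp add: covered_by_sup[OF c(1)])
  then show "cover_irr \<gamma> \<le> cover_irr \<delta>" by (rule \<gamma>(2))
qed

section \<open>Pushes, \<open>rel_A\<close> and \<open>rel_B\<close> in terms of the irreducibles of
  covers\<close>

lemma pushdown_via_perspective:
  assumes "pushdown_via u \<delta> \<gamma>"
  shows "fst \<gamma> \<le> fst \<delta>" "snd \<gamma> \<le> snd \<delta>" "\<not> snd \<gamma> \<le> fst \<delta>"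
proof -
  have *: "fst \<gamma> = u \<sqinter> fst \<delta>" "snd \<gamma> \<le> u" "u < snd \<delta>" "fst \<gamma> < snd \<gamma>"
    using assms by (auto simp: pushdown_via_def Cov_def covered_by_def)
  then show "fst \<gamma> \<le> fst \<delta>" "snd \<gamma> \<le> snd \<delta>" by auto
  show "\<not> snd \<gamma> \<le> fst \<delta>" using * by (metis le_infI less_le_not_le)
qed

lemma pushup_via_perspective:
  assumes "pushup_via w \<gamma> \<delta>"
  shows "fst \<gamma> \<le> fst \<delta>" "snd \<gamma> \<le> snd \<delta>" "\<not> snd \<gamma> \<le> fst \<delta>"
proof -
  have *: "snd \<delta> = w \<squnion> snd \<gamma>" "fst \<gamma> < w" "w \<le> fst \<delta>" "fst \<delta> < snd \<delta>"
    using assms by (auto simp: pushup_via_def Cov_def covered_by_def)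
  then show "fst \<gamma> \<le> fst \<delta>" "snd \<gamma> \<le> snd \<delta>" by auto
  show "\<not> snd \<gamma> \<le> fst \<delta>" using * by (metis le_supI less_le_not_le)
qed

lemma pushdown_cover_irr:
  fixes \<gamma> \<delta> :: "'a::{finite,lattice} \<times> 'a"
  assumes "join_semidistributive TYPE('a)" "pushdown_via u \<delta> \<gamma>"
  shows "cover_irr \<gamma> = cover_irr \<delta>"
  using assms pushdown_via_perspective[OF assms(2)]
  by (intro cover_irr_perspective) (auto simp: pushdown_via_def)

lemma pushup_cover_irr:
  fixes \<gamma> \<delta> :: "'a::{finite,lattice} \<times> 'a"
  assumes "join_semidistributive TYPE('a)" "pushup_via w \<gamma> \<delta>"
  shows "cover_irr \<gamma> = cover_irr \<delta>"
  using assms pushup_via_perspective[OF assms(2)]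
  by (intro cover_irr_perspective) (auto simp: pushup_via_def)

text \<open>The witness of dependency is \<open>fst \<epsilon>\<close>, where
  \<open>\<epsilon>\<close> pushes down to \<open>\<gamma>\<close> and so has the same irreducible.
  If \<open>cover_irr \<delta>\<close> were below both \<open>u\<close> and
  \<open>fst \<epsilon>\<close>, it would be below \<open>fst \<gamma>\<close>, hence below
  \<open>fst \<delta>\<close>.\<close>

lemma rel_A_depends:
  fixes \<gamma> \<delta> :: "'a::{finite,lattice} \<times> 'a"
  assumes sd: "join_semidistributive TYPE('a)" and "rel_A \<delta> \<gamma>"
  shows "depends (cover_irr \<delta>) (cover_irr \<gamma>)"
proof -
  obtain \<epsilon> u where cov: "\<gamma> \<in> Cov" "\<delta> \<in> Cov" "\<epsilon> \<in> Cov" and push: "pushdown_via u \<epsilon> \<gamma>"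
    and le: "snd \<gamma> \<le> fst \<delta>" "snd \<delta> \<le> u"
    using assms(2) by (auto simp: rel_A_def)
  have u: "fst \<gamma> = u \<sqinter> fst \<epsilon>" "u \<le> snd \<epsilon>" "fst \<gamma> \<le> snd \<gamma>"
    using push by (auto simp: pushdown_via_def Cov_def covered_by_def)
  have eq: "cover_irr \<gamma> = cover_irr \<epsilon>" by (rule pushdown_cover_irr[OF sd push])
  note \<gamma> = cover_irr_least[OF sd cov(1)] cover_irr_not_le[OF sd cov(1)]
  note \<delta> = cover_irr_least[OF sd cov(2)] cover_irr_not_le[OF sd cov(2)]
  have "cover_irr \<delta> \<le> snd \<epsilon>" using \<delta>(3) le(2) u(2) by order
  then have "cover_irr \<delta> \<le> cover_irr \<gamma> \<squnion> fst \<epsilon>"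
    using cover_irr_least(1)[OF sd cov(3)] eq by (simp add: sup_commute)
  moreover have "\<not> cover_irr \<delta> \<le> cover_irr \<gamma>" using \<gamma>(3) \<delta>(4) le(1) by order
  moreover have "\<not> cover_irr \<delta> \<le> fst \<epsilon>"
  proof
    assume "cover_irr \<delta> \<le> fst \<epsilon>"
    moreover have "cover_irr \<delta> \<le> u" using \<delta>(3) le(2) by order
    ultimately have "cover_irr \<delta> \<le> fst \<gamma>" by (simp add: u(1))
    then show False using u(3) le(1) \<delta>(4) by order
  qed
  moreover have "\<forall>r<cover_irr \<gamma>. r \<le> fst \<epsilon>" using less_cover_irr[OF sd cov(3)] eq by simp
  ultimately show ?thesis unfolding depends_def by blast
qed

text \<open>Here the witness is \<open>u\<close>: through \<open>fst \<epsilon>\<close> it is above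
  everything strictly below the irreducible of \<open>\<gamma>\<close>, and together they join to
  \<open>snd \<gamma>\<close>.\<close>

lemma rel_B_depends:
  fixes \<gamma> \<delta> :: "'a::{finite,lattice} \<times> 'a"
  assumes sd: "join_semidistributive TYPE('a)" and "rel_B \<delta> \<gamma>"
  shows "depends (cover_irr \<delta>) (cover_irr \<gamma>)"
proof -
  obtain \<epsilon> u where cov: "\<gamma> \<in> Cov" "\<delta> \<in> Cov" "\<epsilon> \<in> Cov" and push: "pushup_via u \<epsilon> \<gamma>"
    and le: "u \<le> fst \<delta>" "snd \<delta> \<le> fst \<gamma>"
    using assms(2) by (auto simp: rel_B_def)
  have u: "snd \<gamma> = u \<squnion> snd \<epsilon>" "fst \<epsilon> \<le> u" "fst \<gamma> \<le> snd \<gamma>"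
    using push by (auto simp: pushup_via_def Cov_def covered_by_def)
  have eq: "cover_irr \<epsilon> = cover_irr \<gamma>" by (rule pushup_cover_irr[OF sd push])
  note \<gamma> = cover_irr_least[OF sd cov(1)] cover_irr_not_le[OF sd cov(1)]
  note \<delta> = cover_irr_least[OF sd cov(2)] cover_irr_not_le[OF sd cov(2)]
  have below: "r \<le> u" if "r < cover_irr \<gamma>" for r
    using less_cover_irr[OF sd cov(3), of r] that eq u(2) by simp
  have "snd \<gamma> = cover_irr \<gamma> \<squnion> u"
    using cover_irr_least(1)[OF sd cov(3)] eq u(1,2)
    by (metis sup.absorb1 sup_assoc sup_commute)
  then have "cover_irr \<delta> \<le> cover_irr \<gamma> \<squnion> u"
    using \<delta>(3) le(2) u(3) by (metis order_trans)
  moreover have not_u: "\<not> cover_irr \<delta> \<le> u" using \<delta>(4) le(1) by order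
  moreover have "\<not> cover_irr \<delta> \<le> cover_irr \<gamma>"
  proof
    assume "cover_irr \<delta> \<le> cover_irr \<gamma>"
    moreover have "cover_irr \<delta> \<noteq> cover_irr \<gamma>" using \<delta>(3) \<gamma>(4) le(2) by (metis order_trans)
    ultimately show False using below not_u by simp
  qed
  ultimately show ?thesis unfolding depends_def using below by blast
qed

lemma cover_irr_lower_cover:
  fixes \<gamma> :: "'a::{finite,lattice} \<times> 'a"
  assumes "join_semidistributive TYPE('a)" "\<gamma> \<in> Cov"
  shows "cover_irr \<gamma> \<sqinter> fst \<gamma> < cover_irr \<gamma>" "r < cover_irr \<gamma> \<Longrightarrow> r \<le> cover_irr \<gamma> \<sqinter> fst \<gamma>"
  using cover_irr_not_le(2)[OF assms] less_cover_irr[OF assms]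
  by (auto simp: less_le_not_le)

section \<open>Forcing between covers\<close>

lemma upper_cover_exists:
  fixes a b :: "'a::{finite,order}"
  assumes "a \<le> b" "a \<noteq> b"
  shows "\<exists>c. a \<prec> c \<and> c \<le> b"
proof -
  obtain c where c: "a < c" "c \<le> b" "\<And>d. a < d \<Longrightarrow> d \<le> b \<Longrightarrow> d \<le> c \<Longrightarrow> c = d"
    using finite_has_minimal2[of "{c. a < c \<and> c \<le> b}" b] assms by (auto simp: less_le)
  have "\<not> (a < d \<and> d < c)" for d using c(2) c(3)[of d] by (metis less_le order_trans)
  with c(1,2) show ?thesis unfolding covered_by_def by blast
qed

lemma lower_cover_exists:
  fixes a b :: "'a::{finite,order}"
  assumes "a \<le> b" "a \<noteq> b"
  shows "\<exists>c. a \<le> c \<and> c \<prec> b"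
proof -
  obtain c where c: "a \<le> c" "c < b" "\<And>d. a \<le> d \<Longrightarrow> d < b \<Longrightarrow> c \<le> d \<Longrightarrow> c = d"
    using finite_has_maximal2[of "{c. a \<le> c \<and> c < b}" a] assms by (auto simp: less_le)
  have "\<not> (c < d \<and> d < b)" for d using c(1) c(3)[of d] by (metis less_le order_trans)
  with c(1,2) show ?thesis unfolding covered_by_def by blast
qed

text \<open>In each rule, every congruence that collapses \<open>\<gamma>\<close> also collapses
  \<open>\<delta>\<close>.\<close>

definition forcing_closed :: "('a::lattice \<times> 'a) set \<Rightarrow> bool" where
  "forcing_closed S \<longleftrightarrow> S \<subseteq> Cov \<and>
     (\<forall>\<gamma> \<delta>. \<gamma> \<in> S \<and> (pushdown \<gamma> \<delta> \<or> pushup \<gamma> \<delta> \<or> rel_A \<delta> \<gamma> \<or> rel_B \<delta> \<gamma>) \<longrightarrow> \<delta> \<in> S)"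

lemma forcing_closedD:
  assumes "forcing_closed S" "\<gamma> \<in> S"
  shows "pushdown_via u \<gamma> \<delta> \<Longrightarrow> \<delta> \<in> S" "pushup_via u \<gamma> \<delta> \<Longrightarrow> \<delta> \<in> S"
    "rel_A \<delta> \<gamma> \<Longrightarrow> \<delta> \<in> S" "rel_B \<delta> \<gamma> \<Longrightarrow> \<delta> \<in> S"
  using assms unfolding forcing_closed_def pushdown_def pushup_def by blast+

text \<open>All covers between \<open>z\<close> and \<open>z \<squnion> b\<close> are forced: those
  with top \<open>z \<squnion> b\<close> by a pushup, and any other, lying below some such
  \<open>e\<close>, by \<open>rel_B\<close> from \<open>(e, z \<squnion> b)\<close>.\<close>

lemma forcing_closed_up:
  fixes S :: "('a::{finite,lattice} \<times> 'a) set"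
  assumes S: "forcing_closed S" "(a, b) \<in> S" and z: "a \<prec> z" "z \<noteq> b"
    and cd: "z \<le> c" "c \<prec> d" "d \<le> z \<squnion> b"
  shows "(c, d) \<in> S"
proof -
  have ab: "a \<prec> b" using S by (auto simp: forcing_closed_def Cov_def)
  have push: "pushup_via z (a, b) (e, z \<squnion> b)" if "z \<le> e" "e \<prec> z \<squnion> b" for e
    using that z ab by (simp add: pushup_via_def Cov_def)
  show ?thesis
  proof (cases "d = z \<squnion> b")
    case True
    then show ?thesis using push[of c] cd forcing_closedD(2)[OF S] by simp
  next
    case False
    then obtain e where e: "d \<le> e" "e \<prec> z \<squnion> b"
      using lower_cover_exists[of d "z \<squnion> b"] cd(3) by auto
    then have "z \<le> e" using cd(1,2) by (auto simp: covered_by_def)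
    note p = push[OF this e(2)]
    then have "(e, z \<squnion> b) \<in> S" by (rule forcing_closedD(2)[OF S])
    moreover have "rel_B (c, d) (e, z \<squnion> b)"
      using p e cd ab unfolding rel_B_def
      by (intro conjI bexI[of _ "(a, b)"] exI[of _ z]) (simp_all add: Cov_def pushup_via_def)
    ultimately show ?thesis by (rule forcing_closedD(4)[OF S(1)])
  qed
qed

text \<open>The dual argument: pushdowns at the bottom of the interval from
  \<open>u \<sqinter> a\<close> to \<open>u\<close>, and \<open>rel_A\<close> elsewhere.\<close>

lemma forcing_closed_down:
  fixes S :: "('a::{finite,lattice} \<times> 'a) set"
  assumes S: "forcing_closed S" "(a, b) \<in> S" and u: "u \<prec> b" "u \<noteq> a"
    and cd: "u \<sqinter> a \<le> c" "c \<prec> d" "d \<le> u"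
  shows "(c, d) \<in> S"
proof -
  have ab: "a \<prec> b" using S by (auto simp: forcing_closed_def Cov_def)
  have push: "pushdown_via u (a, b) (u \<sqinter> a, e)" if "e \<le> u" "u \<sqinter> a \<prec> e" for e
    using that u ab by (simp add: pushdown_via_def Cov_def)
  show ?thesis
  proof (cases "c = u \<sqinter> a")
    case True
    then show ?thesis using push[of d] cd forcing_closedD(1)[OF S] by simp
  next
    case False
    then obtain e where e: "e \<le> c" "u \<sqinter> a \<prec> e"
      using upper_cover_exists[of "u \<sqinter> a" c] cd(1) by auto
    then have "e \<le> u" using cd(2,3) by (auto simp: covered_by_def)
    note p = push[OF this e(2)]
    then have "(u \<sqinter> a, e) \<in> S" by (rule forcing_closedD(1)[OF S])
    moreover have "rel_A (c, d) (u \<sqinter> a, e)"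
      using p e cd ab unfolding rel_A_def
      by (intro conjI bexI[of _ "(a, b)"] exI[of _ u]) (simp_all add: Cov_def pushdown_via_def)
    ultimately show ?thesis by (rule forcing_closedD(3)[OF S(1)])
  qed
qed

section \<open>Transport of forced covers to irreducible elements\<close>

text \<open>Here \<open>x\<close> is meet-irreducible with upper cover \<open>x\<^sub>1\<close>. The
  forced cover climbs, its bottom staying below \<open>x\<close> and its top not, until its bottom
  is \<open>x\<close>; its top is then \<open>x\<^sub>1\<close>.\<close>

lemma forcing_meet_irreducible:
  fixes S :: "('a::{finite,lattice} \<times> 'a) set"
  assumes "forcing_closed S" "(a, b) \<in> S" "a \<le> x" "\<not> b \<le> x"
    and x: "x < x\<^sub>1" "\<And>y. x < y \<Longrightarrow> x\<^sub>1 \<le> y"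
  shows "(x, x\<^sub>1) \<in> S"
  using assms(2-4)
proof (induction "card {y. a < y}" arbitrary: a b rule: less_induct)
  case less
  have ab: "a \<prec> b" using less.prems(1) assms(1) by (auto simp: forcing_closed_def Cov_def)
  show ?case
  proof (cases "a = x")
    case True
    then have "b = x\<^sub>1"
      using x(1) x(2)[of b] ab covered_by_between[OF ab, of x\<^sub>1]
      by (auto simp: covered_by_def)
    with True less.prems(1) show ?thesis by simp
  next
    case False
    then obtain z where z: "a \<prec> z" "z \<le> x"
      using upper_cover_exists[of a x] less.prems(2) by auto
    \<comment> \<open>The largest element below both \<open>x\<close> and
      \<open>z \<squnion> b\<close>, so every upper cover of it within the interval escapes
      \<open>x\<close>.\<close>
    let ?c = "(z \<squnion> b) \<sqinter> x"
    have "?c \<noteq> z \<squnion> b" using less.prems(3) by (metis inf.cobounded2 le_sup_iff)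
    then obtain d where d: "?c \<prec> d" "d \<le> z \<squnion> b"
      using upper_cover_exists[of ?c "z \<squnion> b"] by auto
    have "(?c, d) \<in> S"
      using z d less.prems(3)
      by (intro forcing_closed_up[OF assms(1) less.prems(1) z(1)]) auto
    moreover have "\<not> d \<le> x"
      using d by (metis covered_by_def le_infI less_le_not_le)
    moreover have "card {y. ?c < y} < card {y. a < y}"
    proof (rule psubset_card_mono)
      have "z \<le> ?c" using z by simp
      moreover have "a < z" using z by (simp add: covered_by_def)
      ultimately have "a < ?c" by order
      then show "{y. ?c < y} \<subset> {y. a < y}" by (auto intro: less_trans)
    qed simp
    ultimately show ?thesis using less.hyps by simp
  qed
qed

text \<open>The dual descent, which ends when the top of the cover is \<open>p\<close>.\<close>

lemma forcing_join_irreducible: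
  fixes S :: "('a::{finite,lattice} \<times> 'a) set"
  assumes "forcing_closed S" "(a, b) \<in> S" "p \<le> b" "\<not> p \<le> a"
    and p: "p\<^sub>0 < p" "\<And>y. y < p \<Longrightarrow> y \<le> p\<^sub>0"
  shows "(p\<^sub>0, p) \<in> S"
  using assms(2-4)
proof (induction "card {y. y < b}" arbitrary: a b rule: less_induct)
  case less
  have ab: "a \<prec> b" using less.prems(1) assms(1) by (auto simp: forcing_closed_def Cov_def)
  show ?case
  proof (cases "b = p")
    case True
    then have "a = p\<^sub>0"
      using p(1) less_imp_le[OF p(1)] p(2)[of a] ab covered_by_between[OF ab, of p\<^sub>0]
      by (auto simp: covered_by_def)
    with True less.prems(1) show ?thesis by simp
  next
    case False
    then obtain u where u: "p \<le> u" "u \<prec> b"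
      using lower_cover_exists[of p b] less.prems(2) by auto
    let ?d = "(u \<sqinter> a) \<squnion> p"
    have "?d \<noteq> u \<sqinter> a" using less.prems(3) by (metis sup.cobounded2 le_inf_iff)
    then obtain c where c: "c \<prec> ?d" "u \<sqinter> a \<le> c"
      using lower_cover_exists[of "u \<sqinter> a" ?d] by auto
    have "(c, ?d) \<in> S"
      using u c less.prems(3)
      by (intro forcing_closed_down[OF assms(1) less.prems(1) u(2)]) auto
    moreover have "\<not> p \<le> c"
      using c by (metis covered_by_def le_supI less_le_not_le)
    moreover have "card {y. y < ?d} < card {y. y < b}"
    proof (rule psubset_card_mono)
      have "?d \<le> u" using u by simp
      moreover have "u < b" using u by (simp add: covered_by_def)
      ultimately have "?d < b" by order
      then show "{y. y < ?d} \<subset> {y. y < b}" by (auto intro: less_trans)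
    qed simp
    ultimately show ?thesis using less.hyps by simp
  qed
qed

text \<open>Enlarged to a maximal element not above \<open>p\<close>, the witness \<open>x\<close>
  becomes meet-irreducible with upper cover \<open>x \<squnion> p\<close>. The cover of
  \<open>q\<close> climbs to \<open>(x, x \<squnion> p)\<close>, which then descends to the cover of
  \<open>p\<close>.\<close>

lemma forcing_depends:
  fixes S :: "('a::{finite,lattice} \<times> 'a) set"
  assumes S: "forcing_closed S" "(q\<^sub>0, q) \<in> S" and "depends p q"
    and p: "p\<^sub>0 < p" "\<And>y. y < p \<Longrightarrow> y \<le> p\<^sub>0"
  shows "(p\<^sub>0, p) \<in> S"
proof -
  obtain x' where x': "p \<le> q \<squnion> x'" "\<not> p \<le> x'" "\<And>r. r < q \<Longrightarrow> r \<le> x'"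
    using assms(3) by (auto simp: depends_def)
  obtain x where x: "x' \<le> x" "\<not> p \<le> x" "\<And>y. x' \<le> y \<Longrightarrow> \<not> p \<le> y \<Longrightarrow> x \<le> y \<Longrightarrow> x = y"
    using finite_has_maximal2[of "{x. x' \<le> x \<and> \<not> p \<le> x}" x'] x'(2) by auto
  have "q\<^sub>0 \<le> x'" using x'(3) S by (auto simp: forcing_closed_def Cov_def covered_by_def)
  then have "q\<^sub>0 \<le> x" using x(1) by order
  moreover have "\<not> q \<le> x" using x'(1) x(1,2) by (metis le_supI order_trans)
  moreover have "x < x \<squnion> p" using x(2) by (metis less_le sup.cobounded1 sup.cobounded2)
  moreover have "x \<squnion> p \<le> y" if "x < y" for y
    using x(3)[of y] x(1) that by (metis le_supI less_le order_trans)
  ultimately have "(x, x \<squnion> p) \<in> S"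
    by (rule forcing_meet_irreducible[OF S])
  then show ?thesis
    by (rule forcing_join_irreducible[OF S(1) _ sup_ge2 x(2) p])
qed

section \<open>Labels along join dependencies\<close>

text \<open>Pushes preserve both the label and the irreducible, while \<open>rel_A\<close> and
  \<open>rel_B\<close> raise the label.\<close>

lemma forcing_closed_labels:
  fixes f :: "'a::{finite,lattice} \<times> 'a \<Rightarrow> nat"
  assumes sd: "join_semidistributive TYPE('a)" and f: "strict_facet_labelling f"
  shows "forcing_closed {\<gamma> \<in> Cov. n < f \<gamma> \<or> f \<gamma> = n \<and> cover_irr \<gamma> = q}"
proof -
  have Cov: "\<gamma> \<in> Cov \<and> \<delta> \<in> Cov"
    if "pushdown \<gamma> \<delta> \<or> pushup \<gamma> \<delta> \<or> rel_A \<delta> \<gamma> \<or> rel_B \<delta> \<gamma>" for \<gamma> \<delta> :: "'a \<times> 'a"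
    using that by (auto simp: pushdown_def pushup_def pushdown_via_def pushup_via_def
        rel_A_def rel_B_def)
  have push: "f \<delta> = f \<gamma> \<and> cover_irr \<delta> = cover_irr \<gamma>" if "pushdown \<gamma> \<delta> \<or> pushup \<gamma> \<delta>" for \<gamma> \<delta>
    using that f Cov[of \<gamma> \<delta>] pushdown_cover_irr[OF sd] pushup_cover_irr[OF sd]
    unfolding strict_facet_labelling_def strict_lower_facet_labelling_def
      strict_upper_facet_labelling_def pushdown_def pushup_def by metis
  have rel: "f \<gamma> < f \<delta>" if "rel_A \<delta> \<gamma> \<or> rel_B \<delta> \<gamma>" for \<gamma> \<delta>
    using that f Cov[of \<gamma> \<delta>]
    unfolding strict_facet_labelling_def strict_lower_facet_labelling_def
      strict_upper_facet_labelling_def by metis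
  show ?thesis
    unfolding forcing_closed_def
  proof (intro conjI allI impI)
    fix \<gamma> \<delta> :: "'a \<times> 'a"
    assume "\<gamma> \<in> {\<gamma> \<in> Cov. n < f \<gamma> \<or> f \<gamma> = n \<and> cover_irr \<gamma> = q} \<and>
      (pushdown \<gamma> \<delta> \<or> pushup \<gamma> \<delta> \<or> rel_A \<delta> \<gamma> \<or> rel_B \<delta> \<gamma>)"
    moreover from this have "\<delta> \<in> Cov" using Cov by blast
    moreover have "f \<gamma> < f \<delta> \<or> f \<delta> = f \<gamma> \<and> cover_irr \<delta> = cover_irr \<gamma>"
      using calculation push rel by blast
    ultimately show "\<delta> \<in> {\<gamma> \<in> Cov. n < f \<gamma> \<or> f \<gamma> = n \<and> cover_irr \<gamma> = q}"
      by auto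
  qed auto
qed

text \<open>Forcing leads from \<open>(q\<^sub>0, q)\<close> to \<open>(p\<^sub>0, p)\<close> inside
  the closed set for \<open>n = f (q\<^sub>0, q)\<close>. Equal labels would give equal
  irreducibles, that is \<open>p = q\<close>, contrary to dependency.\<close>

lemma labelling_depends_less:
  fixes f :: "'a::{finite,lattice} \<times> 'a \<Rightarrow> nat"
  assumes sd: "join_semidistributive TYPE('a)" and f: "strict_facet_labelling f"
    and dep: "depends p q"
    and p: "p\<^sub>0 < p" "\<And>y. y < p \<Longrightarrow> y \<le> p\<^sub>0"
    and q: "q\<^sub>0 < q" "\<And>y. y < q \<Longrightarrow> y \<le> q\<^sub>0"
  shows "f (q\<^sub>0, q) < f (p\<^sub>0, p)"
proof -
  have Cov: "(a\<^sub>0, a) \<in> Cov" if "a\<^sub>0 < a" "\<And>y. y < a \<Longrightarrow> y \<le> a\<^sub>0" for a a\<^sub>0 :: 'a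
    unfolding Cov_def covered_by_def using that(1) that(2) by (fastforce dest: leD)
  have irr: "cover_irr (a\<^sub>0, a) = a" if "a\<^sub>0 < a" "\<And>y. y < a \<Longrightarrow> y \<le> a\<^sub>0" for a a\<^sub>0 :: 'a
    using cover_irr_not_le[OF sd Cov[OF that]] that(2)[of "cover_irr (a\<^sub>0, a)"]
    by (simp, metis less_le)
  let ?S = "{\<gamma> \<in> Cov. f (q\<^sub>0, q) < f \<gamma> \<or> f \<gamma> = f (q\<^sub>0, q) \<and> cover_irr \<gamma> = q}"
  have "(q\<^sub>0, q) \<in> ?S" using Cov[OF q] irr[OF q] by simp
  then have "(p\<^sub>0, p) \<in> ?S"
    by (rule forcing_depends[OF forcing_closed_labels[OF sd f] _ dep p])
  moreover have "p \<noteq> q" using dep by (auto simp: depends_def)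
  ultimately show ?thesis using irr[OF p] by auto
qed

section \<open>Construction of least preimages\<close>

text \<open>A maximal \<open>s\<close> of \<open>T\<close> below \<open>c\<close> must be
  \<open>c\<close>. Otherwise take a lower cover \<open>e\<close> of \<open>c\<close> above
  \<open>s\<close> and a minimal \<open>q\<close> below \<open>c\<close> but not below
  \<open>e\<close>: then \<open>p\<close> depends on \<open>q\<close> with witness
  \<open>e \<squnion> d\<close>, so \<open>s \<squnion> q\<close> lies in \<open>T\<close>.\<close>

lemma minimal_cover_part:
  fixes T :: "'a::{finite,lattice} set"
  assumes T: "t \<in> T" "t \<le> c" "\<And>a b. a \<in> T \<Longrightarrow> b \<in> T \<Longrightarrow> a \<squnion> b \<in> T"
    "\<And>q\<^sub>0 q. q\<^sub>0 < q \<Longrightarrow> (\<And>r. r < q \<Longrightarrow> r \<le> q\<^sub>0) \<Longrightarrow> depends p q \<Longrightarrow> q \<in> T"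
    and p: "p \<le> c \<squnion> d" "\<not> p \<le> c" and min: "\<And>c'. c' < c \<Longrightarrow> \<not> p \<le> c' \<squnion> d"
  shows "c \<in> T"
proof -
  obtain s where s: "s \<in> T" "s \<le> c" "\<And>y. y \<in> T \<Longrightarrow> y \<le> c \<Longrightarrow> s \<le> y \<Longrightarrow> s = y"
    using finite_has_maximal2[of "{t \<in> T. t \<le> c}" t] T(1,2) by auto
  have "s = c"
  proof (rule ccontr)
    assume "s \<noteq> c"
    then obtain e where e: "s \<le> e" "e \<prec> c" using lower_cover_exists[of s c] s(2) by auto
    then have "\<not> c \<le> e" by (auto simp: covered_by_def)
    then obtain q where q: "q \<le> c" "\<not> q \<le> e" "\<And>r. r \<le> c \<Longrightarrow> \<not> r \<le> e \<Longrightarrow> r \<le> q \<Longrightarrow> q = r"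
      using finite_has_minimal2[of "{q. q \<le> c \<and> \<not> q \<le> e}" c] by auto
    have below: "r \<le> e" if "r < q" for r
      using q(1) q(3)[of r] that by (metis less_le order_trans)
    have "e \<squnion> q = c" using covered_by_sup[OF e(2)] q by simp
    then have "p \<le> q \<squnion> (e \<squnion> d)" using p(1) by (simp add: ac_simps)
    moreover have "\<not> p \<le> q" using p(2) q(1) by order
    moreover have "\<not> p \<le> e \<squnion> d" using min e(2) by (simp add: covered_by_def)
    moreover have "\<forall>r<q. r \<le> e \<squnion> d" using below by (auto intro: le_supI1)
    ultimately have "depends p q" unfolding depends_def by blast
    \<comment> \<open>By minimality, \<open>q\<close> is join-irreducible with lower cover
      \<open>q \<sqinter> e\<close>.\<close>
    then have "q \<in> T"
      using T(4)[of "q \<sqinter> e" q] below q(2) by (simp add: less_le_not_le)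
    then have "s = s \<squnion> q" using s(3)[of "s \<squnion> q"] T(3) s(1,2) q(1) by auto
    then have "q \<le> s" by (metis sup.cobounded2)
    then show False using e(1) q(2) by order
  qed
  with s(1) show ?thesis by simp
qed

text \<open>First \<open>a\<close> is shrunk to a minimal \<open>c\<close>, then \<open>b\<close> to
  a minimal \<open>d\<close>. It will be used with \<open>T\<close> the set of elements having least
  preimages.\<close>

lemma cover_refinement:
  fixes T :: "'a::{finite,lattice} set"
  assumes T: "t \<in> T" "\<And>y. t \<le> y" "\<And>a b. a \<in> T \<Longrightarrow> b \<in> T \<Longrightarrow> a \<squnion> b \<in> T"
    "\<And>q\<^sub>0 q. q\<^sub>0 < q \<Longrightarrow> (\<And>r. r < q \<Longrightarrow> r \<le> q\<^sub>0) \<Longrightarrow> depends p q \<Longrightarrow> q \<in> T"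
    and p: "p \<le> a \<squnion> b" "\<not> p \<le> a" "\<not> p \<le> b"
  shows "\<exists>c\<in>T. \<exists>d\<in>T. c \<le> a \<and> d \<le> b \<and> p \<le> c \<squnion> d"
proof -
  have part: "c \<in> T" if "p \<le> c \<squnion> d" "\<not> p \<le> c" "\<And>c'. c' < c \<Longrightarrow> \<not> p \<le> c' \<squnion> d" for c d
  proof (rule minimal_cover_part)
    show "q \<in> T" if "q\<^sub>0 < q" "\<And>r. r < q \<Longrightarrow> r \<le> q\<^sub>0" "depends p q" for q\<^sub>0 q
      using that by (rule T(4))
  qed (fact T that)+
  obtain c where c: "c \<le> a" "p \<le> c \<squnion> b"
    "\<And>c'. c' \<le> a \<Longrightarrow> p \<le> c' \<squnion> b \<Longrightarrow> c' \<le> c \<Longrightarrow> c = c'"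
    using finite_has_minimal2[of "{c. c \<le> a \<and> p \<le> c \<squnion> b}" a] p(1) by auto
  obtain d where d: "d \<le> b" "p \<le> c \<squnion> d"
    "\<And>d'. d' \<le> b \<Longrightarrow> p \<le> c \<squnion> d' \<Longrightarrow> d' \<le> d \<Longrightarrow> d = d'"
    using finite_has_minimal2[of "{d. d \<le> b \<and> p \<le> c \<squnion> d}" b] c(2) by auto
  \<comment> \<open>The choice of \<open>c\<close> was minimal with respect to \<open>b\<close>;
    this passes to the smaller \<open>d\<close>.\<close>
  have "\<not> p \<le> c' \<squnion> d" if "c' < c" for c'
  proof
    assume "p \<le> c' \<squnion> d"
    then have "p \<le> c' \<squnion> b" using d(1) by (meson order_refl order_trans sup_mono)
    then show False using c(1) c(3)[of c'] that by (metis less_le order_trans)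
  qed
  moreover have "\<not> p \<le> c" using c(1) p(2) by order
  ultimately have "c \<in> T" using part d(2) by blast
  have "\<not> p \<le> d' \<squnion> c" if "d' < d" for d'
    using d(1) d(3)[of d'] that by (metis less_le order_trans sup_commute)
  moreover have "\<not> p \<le> d" using d(1) p(3) by order
  ultimately have "d \<in> T" using part[of d c] d(2) by (simp add: sup_commute)
  with \<open>c \<in> T\<close> c(1) d(1,2) show ?thesis by blast
qed

section \<open>Least preimages under the extension of a map on generators\<close>

lemma free_extend_simps:
  "free_extend h (free_gen x) = h x"
  "free_extend h (a \<squnion> b) = free_extend h a \<squnion> free_extend h b"
  "free_extend h (a \<sqinter> b) = free_extend h a \<sqinter> free_extend h b"
  by (transfer, simp)+

definition has_least_preimage :: "'x set \<Rightarrow> ('x \<Rightarrow> 'a::lattice) \<Rightarrow> 'a \<Rightarrow> bool" where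
  "has_least_preimage X h y \<longleftrightarrow> (\<exists>m \<in> free_lattice_on X. y \<le> free_extend h m \<and>
     (\<forall>x \<in> free_lattice_on X. y \<le> free_extend h x \<longrightarrow> m \<le> x))"

lemma has_least_preimage_sup:
  assumes "has_least_preimage X h a" "has_least_preimage X h b"
  shows "has_least_preimage X h (a \<squnion> b)"
proof -
  obtain m n where "m \<in> free_lattice_on X" "a \<le> free_extend h m"
      "\<forall>x \<in> free_lattice_on X. a \<le> free_extend h x \<longrightarrow> m \<le> x"
    "n \<in> free_lattice_on X" "b \<le> free_extend h n"
      "\<forall>x \<in> free_lattice_on X. b \<le> free_extend h x \<longrightarrow> n \<le> x"
    using assms unfolding has_least_preimage_def by blast
  then show ?thesis
    unfolding has_least_preimage_def
    by (intro bexI[of _ "m \<squnion> n"])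
      (auto simp: free_extend_simps intro: free_lattice_on.sup le_supI1 le_supI2)
qed

lemma free_lattice_on_meet_exists:
  assumes "finite G" "G \<noteq> {}" "\<And>g. g \<in> G \<Longrightarrow> g \<in> free_lattice_on X \<and> y \<le> free_extend h g"
  shows "\<exists>m \<in> free_lattice_on X. y \<le> free_extend h m \<and> (\<forall>g\<in>G. m \<le> g)"
  using assms
proof (induction rule: finite_ne_induct)
  case (insert g G)
  then obtain m where "m \<in> free_lattice_on X" "y \<le> free_extend h m" "\<forall>g\<in>G. m \<le> g" by auto
  with insert.prems[of g] show ?case
    by (intro bexI[of _ "g \<sqinter> m"])
      (auto simp: free_extend_simps intro: free_lattice_on.inf le_infI2)
qed auto

text \<open>\<open>C\<close> collects the joins that the least preimage of \<open>y\<close> must lie below, one for each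
  nontrivial join cover of \<open>y\<close>.\<close>

lemma has_least_preimageI:
  assumes "finite X" "h ` X = UNIV" "finite C"
    and C: "\<And>c. c \<in> C \<Longrightarrow> c \<in> free_lattice_on X \<and> y \<le> free_extend h c"
    and cover: "\<And>s t. s \<in> free_lattice_on X \<Longrightarrow> t \<in> free_lattice_on X \<Longrightarrow>
      y \<le> free_extend h s \<squnion> free_extend h t \<Longrightarrow>
      y \<le> free_extend h s \<or> y \<le> free_extend h t \<or> (\<exists>c\<in>C. c \<le> s \<squnion> t)"
  shows "has_least_preimage X h y"
proof -
  \<comment> \<open>A lower bound of \<open>?G\<close> that is mapped above \<open>y\<close> is the
    least preimage: the generators settle the base case of the induction on \<open>w\<close>, and
    \<open>C\<close> its join case.\<close>
  let ?G = "free_gen ` {x \<in> X. y \<le> h x} \<union> C"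
  have "y \<in> h ` X" using assms(2) by simp
  then have "?G \<noteq> {}" by auto
  moreover have "finite ?G" using assms(1,3) by simp
  moreover have "g \<in> free_lattice_on X \<and> y \<le> free_extend h g" if "g \<in> ?G" for g
    using that C by (auto simp: free_extend_simps intro: free_lattice_on.gen)
  ultimately obtain m where m: "m \<in> free_lattice_on X" "y \<le> free_extend h m" "\<forall>g\<in>?G. m \<le> g"
    using free_lattice_on_meet_exists[of ?G X y h] by blast
  have "m \<le> w" if "w \<in> free_lattice_on X" "y \<le> free_extend h w" for w
    using that
  proof (induction rule: free_lattice_on.induct)
    case (gen x)
    then show ?case using m(3) by (auto simp: free_extend_simps)
  next
    case (sup s t)
    then consider "m \<le> s" | "m \<le> t" | c where "c \<in> C" "c \<le> s \<squnion> t"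
      using cover[of s t] by (auto simp: free_extend_simps)
    then show ?case
    proof cases
      case 3
      then have "m \<le> c" using m(3) by blast
      with 3(2) show ?thesis by order
    qed (auto intro: le_supI1 le_supI2)
  next
    case (inf s t)
    then show ?case by (simp add: free_extend_simps)
  qed
  with m(1,2) show ?thesis unfolding has_least_preimage_def by blast
qed

text \<open>Join-irreducibles come first, by induction on \<open>r\<close>: nontrivial join covers
  of \<open>p\<close> refine to covers by elements already known to have least preimages. The
  remaining elements are then reached by joins.\<close>

lemma depends_ranked_least_preimage:
  fixes h :: "'x \<Rightarrow> 'a::{finite,lattice}" and r :: "'a \<times> 'a \<Rightarrow> nat"
  assumes X: "finite X" "h ` X = UNIV"
    and r: "\<And>p\<^sub>0 p q\<^sub>0 q. depends p q \<Longrightarrow> p\<^sub>0 < p \<Longrightarrow> (\<And>y. y < p \<Longrightarrow> y \<le> p\<^sub>0) \<Longrightarrow>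
      q\<^sub>0 < q \<Longrightarrow> (\<And>y. y < q \<Longrightarrow> y \<le> q\<^sub>0) \<Longrightarrow> r (q\<^sub>0, q) < r (p\<^sub>0, p)"
  shows "has_least_preimage X h y"
proof -
  let ?P = "has_least_preimage X h"
  obtain z :: 'a where "\<And>y. y \<le> z \<Longrightarrow> z = y"
    using finite_has_minimal[of "UNIV :: 'a set"] by auto
  then have z: "z \<le> y" for y by (metis inf.cobounded1 inf.cobounded2)
  \<comment> \<open>Everything is mapped above the bottom element \<open>z\<close>, so the cover
    condition is trivial and \<open>C\<close> can be empty.\<close>
  have Pz: "?P z" by (rule has_least_preimageI[OF X, of "{}"]) (auto simp: z)
  define b where "b y = (SOME m. m \<in> free_lattice_on X \<and> y \<le> free_extend h m \<and>
    (\<forall>x \<in> free_lattice_on X. y \<le> free_extend h x \<longrightarrow> m \<le> x))" for y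
  have b: "b y \<in> free_lattice_on X" "y \<le> free_extend h (b y)"
    "\<And>x. x \<in> free_lattice_on X \<Longrightarrow> y \<le> free_extend h x \<Longrightarrow> b y \<le> x" if "?P y" for y
    using someI_ex[of "\<lambda>m. m \<in> free_lattice_on X \<and> y \<le> free_extend h m \<and>
      (\<forall>x \<in> free_lattice_on X. y \<le> free_extend h x \<longrightarrow> m \<le> x)"] that
    unfolding b_def[symmetric] has_least_preimage_def by blast+
  have irr: "?P p" if "p\<^sub>0 < p" "\<And>y. y < p \<Longrightarrow> y \<le> p\<^sub>0" for p\<^sub>0 p
    using that
  proof (induction "r (p\<^sub>0, p)" arbitrary: p\<^sub>0 p rule: less_induct)
    case less
    have dep: "?P q" if "q\<^sub>0 < q" "\<And>y. y < q \<Longrightarrow> y \<le> q\<^sub>0" "depends p q" for q\<^sub>0 q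
      using less.hyps[OF r[OF that(3) less.prems that(1,2)]] that(1,2) by blast
    \<comment> \<open>One join for each cover of \<open>p\<close> by two elements with least
      preimages; finite because the pairs come from a finite lattice.\<close>
    let ?C = "(\<lambda>(c, d). b c \<squnion> b d) ` {(c, d). ?P c \<and> ?P d \<and> p \<le> c \<squnion> d}"
    show ?case
    proof (rule has_least_preimageI[OF X, of ?C])
      show "finite ?C" by simp
      show "c \<in> free_lattice_on X \<and> p \<le> free_extend h c" if c: "c \<in> ?C" for c
      proof -
        obtain d e where "c = b d \<squnion> b e" "?P d" "?P e" "p \<le> d \<squnion> e" using c by auto
        then show ?thesis
          using b(1,2)[of d] b(1,2)[of e] sup_mono[of d _ e]
          by (auto simp: free_extend_simps intro: free_lattice_on.sup order_trans)
      qed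
      fix s t
      assume st: "s \<in> free_lattice_on X" "t \<in> free_lattice_on X"
        "p \<le> free_extend h s \<squnion> free_extend h t"
      show "p \<le> free_extend h s \<or> p \<le> free_extend h t \<or> (\<exists>c\<in>?C. c \<le> s \<squnion> t)"
      proof (rule ccontr)
        assume neg: "\<not> ?thesis"
        have "\<exists>c\<in>Collect ?P. \<exists>d\<in>Collect ?P.
            c \<le> free_extend h s \<and> d \<le> free_extend h t \<and> p \<le> c \<squnion> d"
        \<comment> \<open>\<open>T\<close> contains every join-irreducible that \<open>p\<close>
          depends on, by the induction hypothesis.\<close>
        proof (rule cover_refinement)
          show "z \<in> Collect ?P" "\<And>y. z \<le> y" using Pz z by auto
          show "c \<squnion> d \<in> Collect ?P" if "c \<in> Collect ?P" "d \<in> Collect ?P" for c d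
            using that has_least_preimage_sup by simp
          show "q \<in> Collect ?P" if "q\<^sub>0 < q" "\<And>y. y < q \<Longrightarrow> y \<le> q\<^sub>0" "depends p q" for q\<^sub>0 q
            using dep[OF that] by simp
        qed (use neg st(3) in blast)+
        then obtain c d where cd: "?P c" "?P d" "c \<le> free_extend h s" "d \<le> free_extend h t"
          "p \<le> c \<squnion> d"
          by blast
        then have "b c \<squnion> b d \<le> s \<squnion> t" using b(3)[of c s] b(3)[of d t] st(1,2)
          by (simp add: le_supI1 le_supI2)
        moreover have "b c \<squnion> b d \<in> ?C" using cd by auto
        ultimately show False using neg by blast
      qed
    qed
  qed
  \<comment> \<open>If this maximal \<open>s\<close> were not \<open>y\<close>, a minimal
    \<open>q\<close> below \<open>y\<close> but not below \<open>s\<close> would be join-irreducible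
    with lower cover \<open>q \<sqinter> s\<close>, and \<open>s \<squnion> q\<close> would
    contradict maximality.\<close>
  obtain s where s: "?P s" "s \<le> y" "\<And>t. ?P t \<Longrightarrow> t \<le> y \<Longrightarrow> s \<le> t \<Longrightarrow> s = t"
    using finite_has_maximal2[of "{t. ?P t \<and> t \<le> y}" z] Pz z by auto
  have "s = y"
  proof (rule ccontr)
    assume "s \<noteq> y"
    then have "\<not> y \<le> s" using s(2) by order
    then obtain q where q: "q \<le> y" "\<not> q \<le> s" "\<And>r. r \<le> y \<Longrightarrow> \<not> r \<le> s \<Longrightarrow> r \<le> q \<Longrightarrow> q = r"
      using finite_has_minimal2[of "{q. q \<le> y \<and> \<not> q \<le> s}" y] by auto
    have "a \<le> s" if "a < q" for a using q(1) q(3)[of a] that by (metis less_le order_trans)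
    then have "?P q" using irr[of "q \<sqinter> s" q] q(2) by (simp add: less_le_not_le)
    then have "s = s \<squnion> q" using s(3)[of "s \<squnion> q"] has_least_preimage_sup s(1,2) q(1) by auto
    with q(2) show False by (metis sup.cobounded2)
  qed
  with s(1) show ?thesis by simp
qed

section \<open>Labels from ranks, and least preimages from labels\<close>

theorem theorem5p18:
  "lower_bounded_lattice TYPE('a::{finite,lattice}) \<longleftrightarrow>
     join_semidistributive TYPE('a) \<and>
     (\<exists>f :: 'a \<times> 'a \<Rightarrow> nat. strict_facet_labelling f)"
proof
  assume "lower_bounded_lattice TYPE('a)"
  then obtain X and f :: "nat free_lattice \<Rightarrow> 'a" where
    hom: "lattice_hom_on (free_lattice_on X) f" and onto: "f ` free_lattice_on X = UNIV" and
    least: "\<And>y. {x \<in> free_lattice_on X. y \<le> f x} = {} \<or>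
       (\<exists>m \<in> {x \<in> free_lattice_on X. y \<le> f x}. \<forall>x \<in> {x \<in> free_lattice_on X. y \<le> f x}. m \<le> x)"
    unfolding lower_bounded_lattice_def by blast
  \<comment> \<open>As \<open>f\<close> is onto, \<open>m\<close> lies below a preimage
    \<open>w\<close> of \<open>y\<close>, so the least element mapped above \<open>y\<close> is
    mapped onto \<open>y\<close>.\<close>
  have "\<exists>m. m \<in> free_lattice_on X \<and> f m = y \<and> (\<forall>x \<in> free_lattice_on X. y \<le> f x \<longrightarrow> m \<le> x)" for y
  proof -
    have "y \<in> f ` free_lattice_on X" using onto by simp
    then obtain w where w: "w \<in> free_lattice_on X" "f w = y" by blast
    then obtain m where m: "m \<in> free_lattice_on X" "y \<le> f m"
      "\<forall>x \<in> free_lattice_on X. y \<le> f x \<longrightarrow> m \<le> x"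
      using least[of y] by auto
    then have "m \<le> w" using w by simp
    then have "f w = f m \<squnion> f w"
      using hom m(1) w(1) unfolding lattice_hom_on_def by (metis sup.absorb2)
    then have "f m = y" using m(2) w(2) by (metis antisym sup.cobounded1)
    with m show ?thesis by blast
  qed
  then obtain \<beta> where "\<And>y. \<beta> y \<in> free_lattice_on X" "\<And>y. f (\<beta> y) = y"
    "\<And>x y. x \<in> free_lattice_on X \<Longrightarrow> y \<le> f x \<Longrightarrow> \<beta> y \<le> x"
    by metis
  with hom interpret lower_bounded_epi X f \<beta> by unfold_locales
  have less: "rank (cover_irr \<gamma>) < rank (cover_irr \<delta>)" if "rel_A \<delta> \<gamma> \<or> rel_B \<delta> \<gamma>" for \<gamma> \<delta>
  proof (rule depends_rank)
    show "depends (cover_irr \<delta>) (cover_irr \<gamma>)"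
      using that rel_A_depends[OF joinSD] rel_B_depends[OF joinSD] by blast
    have "\<delta> \<in> Cov" using that by (auto simp: rel_A_def rel_B_def)
    note lower = cover_irr_lower_cover[OF joinSD this]
    show "cover_irr \<delta> \<sqinter> fst \<delta> < cover_irr \<delta>" by (rule lower(1))
    show "r < cover_irr \<delta> \<Longrightarrow> r \<le> cover_irr \<delta> \<sqinter> fst \<delta>" for r by (rule lower(2))
  qed
  have "rank (cover_irr \<gamma>) = rank (cover_irr \<delta>)" if "pushdown \<delta> \<gamma> \<or> pushup \<delta> \<gamma>" for \<gamma> \<delta>
    using that pushdown_cover_irr[OF joinSD, of _ \<delta> \<gamma>] pushup_cover_irr[OF joinSD, of _ \<delta> \<gamma>]
    by (auto simp: pushdown_def pushup_def)
  \<comment> \<open>The label of a cover is the rank of its irreducible.\<close>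
  with less have "strict_facet_labelling (\<lambda>\<gamma>. rank (cover_irr \<gamma>))"
    unfolding strict_facet_labelling_def strict_lower_facet_labelling_def
      strict_upper_facet_labelling_def by blast
  with joinSD show "join_semidistributive TYPE('a) \<and>
      (\<exists>f :: 'a \<times> 'a \<Rightarrow> nat. strict_facet_labelling f)"
    by blast
next
  assume "join_semidistributive TYPE('a) \<and>
    (\<exists>f :: 'a \<times> 'a \<Rightarrow> nat. strict_facet_labelling f)"
  then obtain g :: "'a \<times> 'a \<Rightarrow> nat" where
    g: "join_semidistributive TYPE('a)" "strict_facet_labelling g" by blast
  \<comment> \<open>The generators enumerate the whole lattice, so every element is the image of a
    generator.\<close>
  obtain n and h :: "nat \<Rightarrow> 'a" where "UNIV = h ` {i. i < n}"
    using finite_imp_nat_seg_image_inj_on[OF finite[of "UNIV :: 'a set"]] by blast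
  note h = this[symmetric]
  let ?X = "{i. i < n}"
  \<comment> \<open>The labelling \<open>g\<close> itself is the rank that decreases along join
    dependencies.\<close>
  have "has_least_preimage ?X h y" for y
    by (rule depends_ranked_least_preimage[OF _ h, of g]) (simp, rule labelling_depends_less[OF g])
  then have "\<forall>y. {x \<in> free_lattice_on ?X. y \<le> free_extend h x} = {} \<or>
      (\<exists>m \<in> {x \<in> free_lattice_on ?X. y \<le> free_extend h x}.
        \<forall>x \<in> {x \<in> free_lattice_on ?X. y \<le> free_extend h x}. m \<le> x)"
    unfolding has_least_preimage_def by (intro allI disjI2) blast
  moreover have "lattice_hom_on (free_lattice_on ?X) (free_extend h)"
    by (simp add: lattice_hom_on_def free_extend_simps)
  moreover have "free_extend h ` free_lattice_on ?X = UNIV"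
  proof -
    have "h i \<in> free_extend h ` free_lattice_on ?X" if "i \<in> ?X" for i
      using imageI[OF free_lattice_on.gen[OF that], of "free_extend h"]
      by (simp add: free_extend_simps)
    then have "h ` ?X \<subseteq> free_extend h ` free_lattice_on ?X" by blast
    with h show ?thesis by auto
  qed
  ultimately show "lower_bounded_lattice TYPE('a)"
    unfolding lower_bounded_lattice_def
    by (intro exI[of _ ?X] exI[of _ "free_extend h"] conjI finite_Collect_less_nat)
qed

end
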